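(* Let $X$ be a multigraph with maximum valency $d>1$. If $d=2$, then every cohesive generalized truncation of $X$ has chromatic number $2$. If $d>2$, then for every integer $k$ with $3\leq k\leq d$ there is a cohesive generalized truncation of $X$ with chromatic number $k$.
   Context: A multigraph may have multiple edges but no loops; it is assumed to have no isolated vertices. Generalized truncation of $X$: take a matching $M_0$ with $|M_0|=|E(X)|$ (on $2|E(X)|$ new vertices) and a bijection $F:E(X)\to M_0$; for each edge $e$ of $X$ with ends $u,v$, label one end of $F(e)$ by $u$ and the other by $v$. For $v\in V(X)$, the cluster $\mathrm{cl}(v)$ is the set of vertices labelled $v$; insert an arbitrary graph $\mathrm{con}(v)$ (constituent) on $\mathrm{cl}(v)$. The result is a generalized truncation of $X$; it is cohesive if every constituent is connected. *)

theory Defs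
  imports Main "HOL-Library.Extended_Nat"
begin

text \<open>Multigraphs have no loops (every edge has exactly two ends) and no isolated vertices.\<close>

record ('v, 'e) pre_multigraph =
  mverts :: "'v set"
  medges :: "'e set"
  ends :: "'e \<Rightarrow> 'v set"

definition multigraph :: "('v, 'e) pre_multigraph \<Rightarrow> bool" where
  "multigraph X \<longleftrightarrow>
     (\<forall>e\<in>medges X. ends X e \<subseteq> mverts X \<and> card (ends X e) = 2) \<and>
     (\<forall>v\<in>mverts X. \<exists>e\<in>medges X. v \<in> ends X e)"

definition incident_edges :: "('v, 'e) pre_multigraph \<Rightarrow> 'v \<Rightarrow> 'e set" where
  "incident_edges X v = {e \<in> medges X. v \<in> ends X e}"

definition valency :: "('v, 'e) pre_multigraph \<Rightarrow> 'v \<Rightarrow> nat" where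
  "valency X v = card (incident_edges X v)"

text \<open>The finiteness condition is needed because \<^const>\<open>card\<close> is 0 on infinite sets.\<close>

definition has_max_valency :: "('v, 'e) pre_multigraph \<Rightarrow> nat \<Rightarrow> bool" where
  "has_max_valency X d \<longleftrightarrow>
     (\<forall>v\<in>mverts X. finite (incident_edges X v) \<and> valency X v \<le> d) \<and>
     (\<exists>v\<in>mverts X. valency X v = d)"

record 'a pre_graph =
  verts :: "'a set"
  edges :: "'a set set"

definition simple_graph :: "'a pre_graph \<Rightarrow> bool" where
  "simple_graph G \<longleftrightarrow> (\<forall>e\<in>edges G. e \<subseteq> verts G \<and> card e = 2)"

definition connected_graph :: "'a pre_graph \<Rightarrow> bool" where
  "connected_graph G \<longleftrightarrow>
     (\<forall>u\<in>verts G. \<forall>v\<in>verts G. (u, v) \<in> {(x, y). {x, y} \<in> edges G}\<^sup>*)"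

definition colorable :: "'a pre_graph \<Rightarrow> nat \<Rightarrow> bool" where
  "colorable G k \<longleftrightarrow>
     (\<exists>c :: 'a \<Rightarrow> nat. c ` verts G \<subseteq> {..<k} \<and>
        (\<forall>u v. {u, v} \<in> edges G \<longrightarrow> c u \<noteq> c v))"

definition chromatic_number :: "'a pre_graph \<Rightarrow> enat" where
  "chromatic_number G = Inf {enat k | k. colorable G k}"

definition perfect_matching_on :: "'w set \<Rightarrow> 'w set set \<Rightarrow> bool" where
  "perfect_matching_on W M \<longleftrightarrow>
     (\<forall>m\<in>M. card m = 2) \<and> \<Union>M = W \<and>
     (\<forall>m\<in>M. \<forall>m'\<in>M. m \<noteq> m' \<longrightarrow> m \<inter> m' = {})"

definition cluster :: "'w set \<Rightarrow> ('w \<Rightarrow> 'v) \<Rightarrow> 'v \<Rightarrow> 'w set" where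
  "cluster W lab v = {w \<in> W. lab w = v}"

text \<open>
  \<open>Y\<close> is the generalized truncation of \<open>X\<close> built from the matching \<open>M\<close> on the vertices of \<open>Y\<close>,
  the bijection \<open>F\<close>, the vertex labelling \<open>lab\<close> and the constituents \<open>con\<close>.
\<close>

definition truncation_by ::
  "('v, 'e) pre_multigraph \<Rightarrow> 'w set set \<Rightarrow> ('e \<Rightarrow> 'w set) \<Rightarrow> ('w \<Rightarrow> 'v) \<Rightarrow>
   ('v \<Rightarrow> 'w pre_graph) \<Rightarrow> 'w pre_graph \<Rightarrow> bool" where
  "truncation_by X M F lab con Y \<longleftrightarrow>
     perfect_matching_on (verts Y) M \<and>
     bij_betw F (medges X) M \<and>
     (\<forall>e\<in>medges X. bij_betw lab (F e) (ends X e)) \<and>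
     (\<forall>v\<in>mverts X. simple_graph (con v) \<and> verts (con v) = cluster (verts Y) lab v) \<and>
     edges Y = M \<union> (\<Union>v\<in>mverts X. edges (con v))"

definition generalized_truncation ::
  "('v, 'e) pre_multigraph \<Rightarrow> 'w pre_graph \<Rightarrow> bool" where
  "generalized_truncation X Y \<longleftrightarrow> (\<exists>M F lab con. truncation_by X M F lab con Y)"

definition cohesive_generalized_truncation ::
  "('v, 'e) pre_multigraph \<Rightarrow> 'w pre_graph \<Rightarrow> bool" where
  "cohesive_generalized_truncation X Y \<longleftrightarrow>
     (\<exists>M F lab con. truncation_by X M F lab con Y \<and>
        (\<forall>v\<in>mverts X. connected_graph (con v)))"

end

theory Submission
  imports Defs
begin

text \<open>
  If \<open>d = 2\<close>, all clusters have at most two elements, so a truncation is the union of two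
  matchings. Extended to fixed-point-free involutions \<open>f\<close> and \<open>g\<close> of two disjoint copies of the
  vertex set, these are properly 2-coloured by the orbits of \<open>f \<circ> g\<close>: each component consists of
  two such orbits, exchanged by \<open>f\<close> and by \<open>g\<close>.

  If \<open>d > 2\<close>, it suffices to colour the half-edges of \<open>X\<close> by \<open>k\<close> colours such that the two halves of
  every edge differ, some vertex \<open>v\<^sub>0\<close> sees all \<open>k\<close> colours, and no other vertex of valency at
  least 2 sees only one colour: as constituents take the complete multipartite graphs given by the
  colour classes. To find the colouring, fix the colours at \<open>v\<^sub>0\<close>, and at every other vertex \<open>v\<close>
  reserve a colour \<open>g v \<in> {0, 1}\<close> for exactly one edge \<open>s v\<close>. Since \<open>k \<ge> 3\<close>, a half-edge whose
  colour is not prescribed has at least two admissible colours, so the edges can be coloured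
  independently, provided that \<open>g\<close> separates the ends of an edge that is prescribed at both.
\<close>

section \<open>Chromatic number\<close>

lemma chromatic_number_eqI:
  assumes "colorable G k" and "\<And>j. colorable G j \<Longrightarrow> k \<le> j"
  shows "chromatic_number G = enat k"
  unfolding chromatic_number_def
proof (rule antisym)
  show "Inf {enat k |k. colorable G k} \<le> enat k"
    using assms(1) by (intro Inf_lower) blast
  show "enat k \<le> Inf {enat k |k. colorable G k}"
    using assms(2) by (intro Inf_greatest) auto
qed

text \<open>Adjacent images must get distinct colours, so a proper colouring is injective along
  \<open>r\<close>. Both halves of the theorem take their lower bound from this.\<close>

lemma colorable_clique_le:
  assumes "colorable G j" and "r ` {..<k} \<subseteq> verts G"
    and "\<And>a b. a < k \<Longrightarrow> b < k \<Longrightarrow> a \<noteq> b \<Longrightarrow> {r a, r b} \<in> edges G"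
  shows "k \<le> j"
proof -
  obtain c :: "'a \<Rightarrow> nat" where c: "c ` verts G \<subseteq> {..<j}"
    "\<And>u v. {u, v} \<in> edges G \<Longrightarrow> c u \<noteq> c v"
    using assms(1) unfolding colorable_def by blast
  have "inj_on (\<lambda>a. c (r a)) {..<k}"
    using c(2) assms(3) by (intro inj_onI) (metis lessThan_iff)
  moreover have "(\<lambda>a. c (r a)) ` {..<k} \<subseteq> {..<j}"
    using c(1) assms(2) by blast
  ultimately have "card {..<k} \<le> card {..<j}"
    by (meson card_inj_on_le finite_lessThan)
  then show ?thesis by simp
qed

section \<open>The union of two matchings is bipartite\<close>

text \<open>Cancelling the outer \<open>f\<close> and \<open>g\<close> turns a counterexample for
  \<open>n + 2\<close> at \<open>x\<close> into one for \<open>n\<close> at \<open>f (g x)\<close>.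
  For 0 and 1 a counterexample would be a fixed point of \<open>f\<close> or of
  \<open>g\<close>.\<close>

lemma involutions_funpow_neq:
  assumes f: "\<And>x. f (f x) = x" "\<And>x. f x \<noteq> x"
    and g: "\<And>x. g (g x) = x" "\<And>x. g x \<noteq> x"
  shows "((f \<circ> g) ^^ n) x \<noteq> f x"
proof (induction n arbitrary: x rule: induct_nat_012)
  case 0
  show ?case using f(2)[of x] by simp
next
  case 1
  show ?case using f(1) g(2)[of x] by simp (metis)
next
  case (ge2 n)
  show ?case
  proof
    assume "((f \<circ> g) ^^ Suc (Suc n)) x = f x"
    then have "f (g (((f \<circ> g) ^^ n) (f (g x)))) = f x"
      by (metis comp_apply funpow.simps(2) funpow_swap1)
    then have "((f \<circ> g) ^^ n) (f (g x)) = f (f (g x))"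
      by (metis f(1) g(1))
    with ge2(1) show False by blast
  qed
qed

lemma fixpoint_free_involutions_2_coloring:
  assumes f: "\<And>x. f (f x) = x" "\<And>x. f x \<noteq> x"
    and g: "\<And>x. g (g x) = x" "\<And>x. g x \<noteq> x"
  shows "\<exists>c :: 'a \<Rightarrow> bool. \<forall>x. c (f x) \<noteq> c x \<and> c (g x) \<noteq> c x"
proof -
  define t where "t = f \<circ> g"
  define R where "R = {(x, y). y = t x \<or> x = t y}\<^sup>*"
  have t_inj: "t x = t y \<Longrightarrow> x = y" for x y
    unfolding t_def by (metis comp_apply f(1) g(1))
  have R_refl: "(x, x) \<in> R" for x
    unfolding R_def by simp
  have R_trans: "(x, y) \<in> R \<Longrightarrow> (y, z) \<in> R \<Longrightarrow> (x, z) \<in> R" for x y z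
    unfolding R_def by (rule rtrancl_trans)
  have "sym {(x, y). y = t x \<or> x = t y}" by (auto simp: sym_def)
  then have R_sym: "(x, y) \<in> R \<Longrightarrow> (y, x) \<in> R" for x y
    unfolding R_def by (meson sym_rtrancl symD)
  \<comment> \<open>\<open>R\<close> allows steps of \<open>t\<close> in both directions, but
    \<open>t\<close> is injective, so opposite steps cancel and a single power, read one way or the
    other, suffices.\<close>
  have R_pow: "\<exists>n. y = (t ^^ n) x \<or> x = (t ^^ n) y" if "(x, y) \<in> R" for x y
    using that unfolding R_def
  proof (induction rule: rtrancl_induct)
    case base
    show ?case by (rule exI[of _ 0]) simp
  next
    case (step y z)
    then obtain n where n: "y = (t ^^ n) x \<or> x = (t ^^ n) y" by blast
    from step(2) have "z = t y \<or> y = t z" by simp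
    then show ?case
    proof
      assume z: "z = t y"
      from n show ?thesis
      proof
        assume "y = (t ^^ n) x"
        with z show ?thesis by (intro exI[of _ "Suc n"]) simp
      next
        assume x: "x = (t ^^ n) y"
        show ?thesis
        proof (cases n)
          case 0
          with x z show ?thesis by (intro exI[of _ 1]) simp
        next
          case (Suc m)
          with x z show ?thesis by (intro exI[of _ m]) (simp add: funpow_swap1)
        qed
      qed
    next
      assume z: "y = t z"
      from n show ?thesis
      proof
        assume y: "y = (t ^^ n) x"
        show ?thesis
        proof (cases n)
          case 0
          with y z show ?thesis by (intro exI[of _ 1]) simp
        next
          case (Suc m)
          with y z have "t z = t ((t ^^ m) x)" by simp
          with t_inj show ?thesis by blast
        qed
      next
        assume "x = (t ^^ n) y"
        with z show ?thesis by (intro exI[of _ "Suc n"]) (simp add: funpow_swap1)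
      qed
    qed
  qed
  have R_f: "(x, f x) \<notin> R" for x
    using R_pow[of x "f x"] involutions_funpow_neq[OF f g] f(1) unfolding t_def by metis
  \<comment> \<open>\<open>f\<close> conjugates \<open>t\<close> to its inverse, hence maps orbits
    to orbits.\<close>
  have f_R: "(f x, f y) \<in> R" if "(x, y) \<in> R" for x y
    using that unfolding R_def
  proof (induction rule: rtrancl_induct)
    case (step y z)
    then have "f y = t (f z) \<or> f z = t (f y)"
      unfolding t_def using f(1) g(1) by auto
    with step(3) show ?case by (auto intro: rtrancl_into_rtrancl)
  qed simp
  have R_g: "(g x, f x) \<in> R" for x
    unfolding R_def t_def using g(1) by (intro r_into_rtrancl) auto
  \<comment> \<open>A component is the union of the orbits of \<open>x\<close> and
    \<open>f x\<close>. The predicate depends only on the component, so one point is chosen in each;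
    the colour of \<open>x\<close> tells whether that point lies in the orbit of
    \<open>x\<close>.\<close>
  define rep where "rep x = (SOME y. (x, y) \<in> R \<or> (f x, y) \<in> R)" for x
  have rep: "(x, rep x) \<in> R \<or> (f x, rep x) \<in> R" for x
    unfolding rep_def by (rule someI[of _ x]) (simp add: R_refl)
  have rep_R: "rep x = rep y" if "(x, y) \<in> R" for x y
  proof -
    have "(x, z) \<in> R \<longleftrightarrow> (y, z) \<in> R" "(f x, z) \<in> R \<longleftrightarrow> (f y, z) \<in> R" for z
      using that f_R[OF that] R_sym R_trans by blast+
    then show ?thesis unfolding rep_def by simp
  qed
  have rep_f: "rep (f x) = rep x" for x
    unfolding rep_def by (simp add: f(1) disj_commute)
  define c where "c x \<longleftrightarrow> (x, rep x) \<in> R" for x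
  have c_f: "c (f x) \<noteq> c x" for x
    using rep[of x] rep_f[of x] R_f[of x] R_sym R_trans unfolding c_def by metis
  have "c (g x) = c (f x)" for x
    using R_g[of x] rep_R[OF R_g[of x]] R_sym R_trans unfolding c_def by metis
  with c_f show ?thesis by (intro exI[of _ c]) auto
qed

text \<open>The second copy supplies partners for unmatched points: such a point is exchanged with
  its own copy, while matched points move along their edge within one copy.\<close>

lemma matching_involution:
  assumes card: "\<And>m. m \<in> M \<Longrightarrow> card m = 2"
    and disj: "\<And>m m'. m \<in> M \<Longrightarrow> m' \<in> M \<Longrightarrow> m \<noteq> m' \<Longrightarrow> m \<inter> m' = {}"
  shows "\<exists>f :: 'a \<times> bool \<Rightarrow> 'a \<times> bool. (\<forall>p. f (f p) = p) \<and> (\<forall>p. f p \<noteq> p) \<and>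
    (\<forall>x y b. {x, y} \<in> M \<longrightarrow> f (x, b) = (y, b))"
proof -
  define q where "q x = (THE y. {x, y} \<in> M)" for x
  have uniq: "y = z" if "{x, y} \<in> M" "{x, z} \<in> M" for x y z
  proof -
    have "{x, y} = {x, z}" using disj[OF that] by blast
    then show ?thesis by (auto simp: doubleton_eq_iff)
  qed
  have q: "q x = y" if "{x, y} \<in> M" for x y
    unfolding q_def using that uniq by (blast intro: the_equality)
  have covered: "{x, q x} \<in> M \<and> q x \<noteq> x \<and> q (q x) = x" if x: "x \<in> \<Union>M" for x
  proof -
    obtain m where m: "m \<in> M" "x \<in> m" using x by blast
    with card obtain a b where ab: "m = {a, b}" "a \<noteq> b" by (metis card_2_iff)
    with m have "\<exists>y. y \<noteq> x \<and> {x, y} \<in> M" by (metis insertE insert_commute singletonD)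
    then obtain y where y: "y \<noteq> x" "{x, y} \<in> M" by blast
    with q[of x y] q[of y x] show ?thesis by (simp add: insert_commute)
  qed
  define f where "f = (\<lambda>(x, b). if x \<in> \<Union>M then (q x, b) else (x, \<not> b))"
  have "f (f p) = p" for p
  proof (cases p)
    case (Pair x b)
    show ?thesis
    proof (cases "x \<in> \<Union>M")
      case True
      then have "q x \<in> \<Union>M" using covered by blast
      with True show ?thesis using covered Pair unfolding f_def by simp
    qed (use Pair in \<open>simp add: f_def\<close>)
  qed
  moreover have "f p \<noteq> p" for p
    using covered unfolding f_def by (cases p) auto
  moreover have "f (x, b) = (y, b)" if "{x, y} \<in> M" for x y b
    using q[OF that] that unfolding f_def by auto
  ultimately show ?thesis by blast
qed

lemma union_matchings_bipartite:
  assumes "\<And>m. m \<in> M \<Longrightarrow> card m = 2"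
    and "\<And>m m'. m \<in> M \<Longrightarrow> m' \<in> M \<Longrightarrow> m \<noteq> m' \<Longrightarrow> m \<inter> m' = {}"
    and "\<And>m. m \<in> N \<Longrightarrow> card m = 2"
    and "\<And>m m'. m \<in> N \<Longrightarrow> m' \<in> N \<Longrightarrow> m \<noteq> m' \<Longrightarrow> m \<inter> m' = {}"
  shows "\<exists>c :: 'a \<Rightarrow> bool. \<forall>x y. {x, y} \<in> M \<union> N \<longrightarrow> c x \<noteq> c y"
proof -
  obtain f :: "'a \<times> bool \<Rightarrow> 'a \<times> bool" where f: "\<And>p. f (f p) = p" "\<And>p. f p \<noteq> p"
    "\<And>x y b. {x, y} \<in> M \<Longrightarrow> f (x, b) = (y, b)"
    using matching_involution[of M] assms(1,2) by metis
  obtain g :: "'a \<times> bool \<Rightarrow> 'a \<times> bool" where g: "\<And>p. g (g p) = p" "\<And>p. g p \<noteq> p"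
    "\<And>x y b. {x, y} \<in> N \<Longrightarrow> g (x, b) = (y, b)"
    using matching_involution[of N] assms(3,4) by metis
  obtain c :: "'a \<times> bool \<Rightarrow> bool" where c: "\<And>p. c (f p) \<noteq> c p" "\<And>p. c (g p) \<noteq> c p"
    using fixpoint_free_involutions_2_coloring[of f g] f(1,2) g(1,2) by metis
  show ?thesis
    by (rule exI[of _ "\<lambda>x. c (x, True)"]) (metis Un_iff c f(3) g(3))
qed

section \<open>Maximum valency two\<close>

text \<open>Send a cluster vertex to the edge of \<open>X\<close> whose matching edge contains it.
  This is injective because \<open>lab\<close> separates the two ends of \<open>F e\<close>.\<close>

lemma card_cluster_le_valency:
  assumes tr: "truncation_by X M F lab con Y" and fin: "finite (incident_edges X v)"
  shows "finite (cluster (verts Y) lab v) \<and> card (cluster (verts Y) lab v) \<le> valency X v"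
proof -
  let ?C = "cluster (verts Y) lab v"
  have M: "\<Union>M = verts Y" "F ` medges X = M"
    and lab: "\<And>e. e \<in> medges X \<Longrightarrow> inj_on lab (F e) \<and> lab ` F e = ends X e"
    using tr unfolding truncation_by_def perfect_matching_on_def bij_betw_def by simp_all
  have "\<forall>w\<in>?C. \<exists>e\<in>medges X. w \<in> F e"
    using M unfolding cluster_def by blast
  then obtain E where E: "\<And>w. w \<in> ?C \<Longrightarrow> E w \<in> medges X \<and> w \<in> F (E w)"
    by metis
  have "E ` ?C \<subseteq> incident_edges X v"
    using E lab unfolding incident_edges_def cluster_def by blast
  moreover have "inj_on E ?C"
  proof (rule inj_onI)
    fix x y assume xy: "x \<in> ?C" "y \<in> ?C" "E x = E y"
    then have "lab x = lab y" unfolding cluster_def by simp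
    then show "x = y"
      using E[OF xy(1)] E[OF xy(2)] xy(3) lab[of "E x"] by (auto dest: inj_onD)
  qed
  ultimately show ?thesis
    unfolding valency_def using fin by (meson card_inj_on_le inj_on_finite)
qed

lemma chromatic_number_truncation_valency_2:
  assumes "multigraph X" and "has_max_valency X 2"
    and tr: "truncation_by X M F lab con Y"
  shows "chromatic_number Y = 2"
proof -
  define N where "N = (\<Union>v\<in>mverts X. edges (con v))"
  have M: "\<And>m. m \<in> M \<Longrightarrow> card m = 2" "\<Union>M = verts Y" "F ` medges X = M"
    "\<And>m m'. m \<in> M \<Longrightarrow> m' \<in> M \<Longrightarrow> m \<noteq> m' \<Longrightarrow> m \<inter> m' = {}"
    and Y: "edges Y = M \<union> N"
    and con: "\<And>v. v \<in> mverts X \<Longrightarrow> simple_graph (con v) \<and> verts (con v) = cluster (verts Y) lab v"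
    using tr unfolding truncation_by_def perfect_matching_on_def bij_betw_def N_def by simp_all
  \<comment> \<open>A constituent edge has two vertices in a cluster of size at most two, so it
    fills the cluster. Distinct constituent edges thus come from distinct clusters, and
    \<open>N\<close> is a matching.\<close>
  have N: "card m = 2 \<and> (\<exists>v. m = cluster (verts Y) lab v)" if m_N: "m \<in> N" for m
  proof -
    obtain v where v: "v \<in> mverts X" "m \<in> edges (con v)"
      using m_N unfolding N_def by blast
    with con have m: "m \<subseteq> cluster (verts Y) lab v" "card m = 2"
      unfolding simple_graph_def by blast+
    have "finite (incident_edges X v)" "valency X v \<le> 2"
      using assms(2) v(1) unfolding has_max_valency_def by blast+
    with card_cluster_le_valency[OF tr] m have "m = cluster (verts Y) lab v"
      by (metis card_seteq le_trans)
    with m(2) show ?thesis by blast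
  qed
  have N_disj: "m \<inter> m' = {}" if "m \<in> N" "m' \<in> N" "m \<noteq> m'" for m m'
    using N[OF that(1)] N[OF that(2)] that(3) unfolding cluster_def by auto
  have N_card: "card m = 2" if "m \<in> N" for m
    using N[OF that] by simp
  have "\<exists>c :: 'c \<Rightarrow> bool. \<forall>x y. {x, y} \<in> M \<union> N \<longrightarrow> c x \<noteq> c y"
    by (rule union_matchings_bipartite) (fact M N_card N_disj)+
  then obtain c :: "'c \<Rightarrow> bool" where c: "\<And>x y. {x, y} \<in> M \<union> N \<Longrightarrow> c x \<noteq> c y"
    by blast
  have "colorable Y 2"
    unfolding colorable_def Y
  proof (intro exI[of _ "\<lambda>x. of_bool (c x)"] conjI allI impI)
    show "(\<lambda>x. of_bool (c x)) ` verts Y \<subseteq> {..<2::nat}" by auto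
    show "of_bool (c u) \<noteq> (of_bool (c v) :: nat)" if "{u, v} \<in> M \<union> N" for u v
      using c[OF that] by simp
  qed
  moreover have "2 \<le> j" if "colorable Y j" for j
  proof -
    \<comment> \<open>The maximum valency is attained at some vertex, and that vertex is not
      isolated.\<close>
    obtain e where "e \<in> medges X"
      using assms(1,2) unfolding multigraph_def has_max_valency_def by blast
    with M(3) have "F e \<in> M" by blast
    with M(1) obtain a b where ab: "{a, b} \<in> M" by (metis card_2_iff)
    show ?thesis
    proof (rule colorable_clique_le[OF that, where r = "\<lambda>i. if i = 0 then a else b"])
      show "(\<lambda>i. if i = 0 then a else b) ` {..<2} \<subseteq> verts Y"
        using ab M(2) by auto
    qed (use ab Y in \<open>auto simp: insert_commute\<close>)
  qed
  ultimately have "chromatic_number Y = enat 2" by (rule chromatic_number_eqI)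
  then show ?thesis by (simp add: numeral_eq_enat)
qed

section \<open>Truncations from colourings of the half-edges\<close>

definition multipartite_graph :: "'a set \<Rightarrow> ('a \<Rightarrow> 'b) \<Rightarrow> 'a pre_graph" where
  "multipartite_graph A c =
     \<lparr>verts = A, edges = {{x, y} |x y. x \<in> A \<and> y \<in> A \<and> c x \<noteq> c y}\<rparr>"

lemma simple_multipartite_graph: "simple_graph (multipartite_graph A c)"
  unfolding simple_graph_def multipartite_graph_def by (auto simp: card_insert_if)

lemma edge_multipartite_graph_iff:
  "{x, y} \<in> edges (multipartite_graph A c) \<longleftrightarrow> x \<in> A \<and> y \<in> A \<and> c x \<noteq> c y"
  unfolding multipartite_graph_def by (auto simp: doubleton_eq_iff)

lemma verts_multipartite_graph [simp]: "verts (multipartite_graph A c) = A"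
  unfolding multipartite_graph_def by simp

text \<open>Two vertices of the same part are joined through a vertex outside it. The hypothesis is
  vacuous for a one-element \<open>A\<close>, which covers vertices of valency 1.\<close>

lemma connected_multipartite_graph:
  assumes "\<And>x y. x \<in> A \<Longrightarrow> y \<in> A \<Longrightarrow> x \<noteq> y \<Longrightarrow> c x = c y \<Longrightarrow> \<exists>z\<in>A. c z \<noteq> c x"
  shows "connected_graph (multipartite_graph A c)"
  unfolding connected_graph_def
proof (intro ballI)
  let ?R = "{(x, y). {x, y} \<in> edges (multipartite_graph A c)}"
  fix x y assume "x \<in> verts (multipartite_graph A c)" "y \<in> verts (multipartite_graph A c)"
  then have xy: "x \<in> A" "y \<in> A" by simp_all
  consider "x = y" | "c x \<noteq> c y" | "x \<noteq> y" "c x = c y" by blast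
  then show "(x, y) \<in> ?R\<^sup>*"
  proof cases
    case 3
    with assms xy obtain z where "z \<in> A" "c z \<noteq> c x" by blast
    with 3 xy have "(x, z) \<in> ?R" "(z, y) \<in> ?R"
      by (auto simp: edge_multipartite_graph_iff)
    then show ?thesis by (meson rtrancl.simps)
  qed (use xy in \<open>auto simp: edge_multipartite_graph_iff\<close>)
qed

text \<open>The vertices of \<open>Y\<close> are the half-edges \<open>(e, v)\<close>, coloured by
  \<open>c e v\<close>. Constituents join only different colours and \<open>c_inj\<close> handles
  the matching, so the colouring is proper; one half-edge of each colour at \<open>v0\<close> gives
  a clique of size \<open>k\<close>.\<close>

lemma truncation_from_coloring:
  fixes X :: "('v, 'e) pre_multigraph" and c :: "'e \<Rightarrow> 'v \<Rightarrow> nat"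
  assumes X: "multigraph X"
    and c_less: "\<And>e v. e \<in> medges X \<Longrightarrow> v \<in> ends X e \<Longrightarrow> c e v < k"
    and c_inj: "\<And>e. e \<in> medges X \<Longrightarrow> inj_on (c e) (ends X e)"
    and c_nonconst: "\<And>v e e'. e \<in> incident_edges X v \<Longrightarrow> e' \<in> incident_edges X v \<Longrightarrow> e \<noteq> e' \<Longrightarrow>
      c e v = c e' v \<Longrightarrow> \<exists>a\<in>incident_edges X v. c a v \<noteq> c e v"
    and v0: "v0 \<in> mverts X" "{..<k} \<subseteq> (\<lambda>e. c e v0) ` incident_edges X v0"
  shows "\<exists>Y :: ('e \<times> 'v) pre_graph.
    cohesive_generalized_truncation X Y \<and> chromatic_number Y = enat k"
proof -
  define F where "F e = {e} \<times> ends X e" for e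
  define M where "M = F ` medges X"
  define W where "W = Sigma (medges X) (ends X)"
  define col where "col = (\<lambda>(e, v). c e v)"
  define con where "con v = multipartite_graph (cluster W snd v) col" for v
  define Y where "Y = \<lparr>verts = W, edges = M \<union> (\<Union>v\<in>mverts X. edges (con v))\<rparr>"
  have card_ends: "card (ends X e) = 2" if "e \<in> medges X" for e
    using X that unfolding multigraph_def by blast
  have cl: "(e, w) \<in> cluster W snd v \<longleftrightarrow> w = v \<and> e \<in> incident_edges X v" for e w v
    unfolding cluster_def W_def incident_edges_def by auto
  have F_disj: "e = e'" if "e \<in> medges X" "F e \<inter> F e' \<noteq> {}" for e e'
    using that unfolding F_def by auto
  \<comment> \<open>Nonemptiness turns the disjointness of the sets \<open>F e\<close> into
    injectivity of \<open>F\<close>.\<close>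
  have "F e \<noteq> {}" if "e \<in> medges X" for e
    using card_ends[OF that] unfolding F_def by auto
  then have "bij_betw F (medges X) M"
    unfolding M_def bij_betw_def using F_disj by (metis inf.idem inj_onI)
  moreover have "perfect_matching_on W M"
    unfolding perfect_matching_on_def
  proof (intro conjI ballI impI)
    show "card m = 2" if "m \<in> M" for m
      using that card_ends unfolding M_def F_def by (auto simp: card_cartesian_product)
    show "\<Union>M = W" unfolding M_def W_def F_def by auto
    show "m \<inter> m' = {}" if "m \<in> M" "m' \<in> M" "m \<noteq> m'" for m m'
      using that F_disj unfolding M_def by blast
  qed
  moreover have "bij_betw snd (F e) (ends X e)" for e
    unfolding F_def bij_betw_def by (auto simp: inj_on_def)
  ultimately have tr: "truncation_by X M F snd con Y"
    unfolding truncation_by_def Y_def con_def by (simp add: simple_multipartite_graph)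
  have "connected_graph (con v)" for v
    unfolding con_def
  proof (rule connected_multipartite_graph)
    fix x y assume xy: "x \<in> cluster W snd v" "y \<in> cluster W snd v" "x \<noteq> y" "col x = col y"
    obtain e e' where e: "x = (e, v)" "y = (e', v)"
      using xy(1,2) cl by (metis surj_pair)
    with xy cl c_nonconst[of e v e'] obtain a where "a \<in> incident_edges X v" "c a v \<noteq> c e v"
      unfolding col_def by auto
    with e cl show "\<exists>z\<in>cluster W snd v. col z \<noteq> col x"
      unfolding col_def by (intro bexI[of _ "(a, v)"]) auto
  qed
  with tr have "cohesive_generalized_truncation X Y"
    unfolding cohesive_generalized_truncation_def by blast
  moreover have "chromatic_number Y = enat k"
  proof (rule chromatic_number_eqI)
    have "col x \<noteq> col y" if xy: "{x, y} \<in> edges Y" for x y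
    proof (cases "{x, y} \<in> M")
      case True
      then obtain e where e: "e \<in> medges X" "{x, y} = {e} \<times> ends X e"
        unfolding M_def F_def by blast
      then obtain u v where uv: "x = (e, u)" "y = (e, v)" "u \<in> ends X e" "v \<in> ends X e"
        by (metis SigmaE insertCI singletonD)
      have "card {x, y} = 2"
        using e card_ends by (simp add: card_cartesian_product)
      with uv have "u \<noteq> v" by auto
      with c_inj[OF e(1)] uv show ?thesis
        unfolding col_def by (auto simp: inj_on_eq_iff)
    next
      case False
      with xy show ?thesis
        unfolding Y_def con_def by (auto simp: edge_multipartite_graph_iff)
    qed
    moreover have "col ` verts Y \<subseteq> {..<k}"
      using c_less unfolding Y_def W_def col_def by auto
    ultimately show "colorable Y k"
      unfolding colorable_def by blast
    obtain r where r: "\<And>i. i < k \<Longrightarrow> r i \<in> incident_edges X v0 \<and> c (r i) v0 = i"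
      using v0(2) by (metis (no_types, lifting) image_iff lessThan_iff subsetD)
    show "k \<le> j" if "colorable Y j" for j
    proof (rule colorable_clique_le[OF that, where r = "\<lambda>i. (r i, v0)"])
      show "(\<lambda>i. (r i, v0)) ` {..<k} \<subseteq> verts Y"
        using r unfolding Y_def W_def incident_edges_def by auto
      fix a b assume "a < k" "b < k" "a \<noteq> b"
      with r cl have "{(r a, v0), (r b, v0)} \<in> edges (con v0)"
        unfolding con_def edge_multipartite_graph_iff col_def by simp
      with v0(1) show "{(r a, v0), (r b, v0)} \<in> edges Y"
        unfolding Y_def by auto
    qed
  qed
  ultimately show ?thesis by blast
qed

lemma truncation_with_chromatic_number:
  fixes X :: "('v, 'e) pre_multigraph"
  assumes X: "multigraph X" and d: "has_max_valency X d" and k: "3 \<le> k" "k \<le> d"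
  shows "\<exists>Y :: ('e \<times> 'v) pre_graph.
    cohesive_generalized_truncation X Y \<and> chromatic_number Y = enat k"
proof -
  obtain v0 where v0: "v0 \<in> mverts X" "card (incident_edges X v0) = d"
    "finite (incident_edges X v0)"
    using d unfolding has_max_valency_def valency_def by blast
  obtain b where b: "bij_betw b (incident_edges X v0) {0..<d}"
    using ex_bij_betw_finite_nat[OF v0(3)] v0(2) by blast
  \<comment> \<open>Reducing a numbering of the \<open>d\<close> edges at \<open>v0\<close> modulo
    \<open>k\<close> hits every colour, because \<open>k \<le> d\<close>.\<close>
  define c0 where "c0 e = b e mod k" for e
  have c0_less: "c0 e < k" for e
    using k unfolding c0_def by simp
  have c0_onto: "\<exists>e\<in>incident_edges X v0. c0 e = i" if "i < k" for i
  proof -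
    have "i \<in> b ` incident_edges X v0" using that k b unfolding bij_betw_def by auto
    then obtain e where "e \<in> incident_edges X v0" "b e = i" by blast
    with that show ?thesis unfolding c0_def by (intro bexI[of _ e]) auto
  qed
  have ends2: "\<exists>u v. ends X e = {u, v} \<and> u \<noteq> v" if "e \<in> medges X" for e
    using X that unfolding multigraph_def by (meson card_2_iff)
  define s where "s v = (SOME e. e \<in> incident_edges X v)" for v
  have s: "s v \<in> incident_edges X v" if "e \<in> incident_edges X v" for e v
    unfolding s_def using that by (rule someI)
  have "\<forall>e\<in>medges X. \<exists>w. w \<in> ends X e \<and> (v0 \<in> ends X e \<longrightarrow> (w = v0 \<longleftrightarrow> c0 e = 0))"
    using ends2 by (metis insertCI)
  \<comment> \<open>The end \<open>h e\<close> of \<open>e\<close> is the one that may reserve the colour 0 for \<open>e\<close>.\<close>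
  then obtain h where h: "\<And>e. e \<in> medges X \<Longrightarrow> h e \<in> ends X e"
    "\<And>e. e \<in> medges X \<Longrightarrow> v0 \<in> ends X e \<Longrightarrow> h e = v0 \<longleftrightarrow> c0 e = 0"
    by metis
  define g :: "'v \<Rightarrow> nat" where "g v = (if h (s v) = v then 0 else 1)" for v
  \<comment> \<open>\<open>L e v\<close> is the set of admissible colours. Removing
    \<open>g v\<close> from all other edges at \<open>v\<close> makes \<open>s v\<close> the only
    edge with that colour there.\<close>
  define L where "L e v = (if v = v0 then {c0 e} else if e = s v then {g v} else {..<k} - {g v})"
    for e v
  have free: "\<exists>x \<in> {..<k} - {i}. x \<noteq> j" for i j :: nat
  proof -
    have "\<exists>x \<in> {0, 1, 2::nat}. x \<noteq> i \<and> x \<noteq> j" by auto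
    then show ?thesis using k by auto
  qed
  have single: "\<exists>i. L e v = {i}" if "v = v0 \<or> e = s v" for e v
    using that unfolding L_def by auto
  have big: "\<exists>x\<in>L e v. x \<noteq> j" if "\<not> (v = v0 \<or> e = s v)" for e v j
    using that free unfolding L_def by auto
  have L_ne: "\<exists>x. x \<in> L e v" for e v
    using single[of v e] big[of v e] by blast
  \<comment> \<open>If \<open>u = v0\<close>, the choice of \<open>h\<close> makes
    \<open>g v\<close> equal to 1 when \<open>c0 e = 0\<close>, and 0 otherwise. If \<open>e\<close>
    is reserved at both ends, exactly one of them is \<open>h e\<close>, so \<open>g\<close> takes
    both values.\<close>
  have g_neq: "\<exists>x\<in>L e u. \<exists>y\<in>L e v. x \<noteq> y"
    if e: "e \<in> medges X" "ends X e = {u, v}" "u \<noteq> v"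
      and u: "u = v0 \<or> e = s u" and v: "v \<noteq> v0" "e = s v" for e u v
  proof (cases "u = v0")
    case True
    then show ?thesis
      using h[OF e(1)] e v unfolding L_def g_def by (cases "c0 e = 0") auto
  next
    case False
    then show ?thesis
      using h(1)[OF e(1)] e u v unfolding L_def g_def by auto
  qed
  have pair: "\<exists>x\<in>L e u. \<exists>y\<in>L e v. x \<noteq> y"
    if e: "e \<in> medges X" "ends X e = {u, v}" "u \<noteq> v" for e u v
  proof (cases "(u = v0 \<or> e = s u) \<and> (v = v0 \<or> e = s v)")
    case True
    show ?thesis
    proof (cases "v = v0")
      case False
      with True g_neq[OF e] show ?thesis by blast
    next
      case v: True
      have "ends X e = {v, u}" using e(2) by blast
      with v True e g_neq[of e v u] show ?thesis by metis
    qed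
  next
    case False
    then show ?thesis using big L_ne by metis
  qed
  \<comment> \<open>The lists already encode the conditions at the vertices, so each edge can be
    coloured separately.\<close>
  have "\<exists>f. inj_on f (ends X e) \<and> (\<forall>v\<in>ends X e. f v \<in> L e v)" if e: "e \<in> medges X" for e
  proof -
    obtain u v where uv: "ends X e = {u, v}" "u \<noteq> v" using ends2[OF e] by blast
    with pair e obtain x y where "x \<in> L e u" "y \<in> L e v" "x \<noteq> y" by blast
    with uv show ?thesis
      by (intro exI[of _ "\<lambda>w. if w = u then x else y"]) (auto simp: inj_on_def)
  qed
  then obtain c where c: "\<And>e. e \<in> medges X \<Longrightarrow> inj_on (c e) (ends X e)"
    "\<And>e v. e \<in> medges X \<Longrightarrow> v \<in> ends X e \<Longrightarrow> c e v \<in> L e v"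
    by metis
  have c_inc: "c e v \<in> L e v" if "e \<in> incident_edges X v" for e v
    using that c(2) unfolding incident_edges_def by blast
  have c_v0: "c e v0 = c0 e" if "e \<in> incident_edges X v0" for e
    using c_inc[OF that] unfolding L_def by simp
  have L_less: "L e v \<subseteq> {..<k}" for e v
    unfolding L_def g_def using c0_less k by auto
  show ?thesis
  proof (rule truncation_from_coloring[OF X _ c(1) _ v0(1)])
    show "c e v < k" if "e \<in> medges X" "v \<in> ends X e" for e v
      using c(2)[OF that] L_less by blast
    show "\<exists>a\<in>incident_edges X v. c a v \<noteq> c e v"
      if e: "e \<in> incident_edges X v" "e' \<in> incident_edges X v" "e \<noteq> e'" "c e v = c e' v"
      for v e e'
    proof (cases "v = v0")
      case True
      have "\<exists>i<k. i \<noteq> c e v" using free[of "c e v" "c e v"] by blast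
      with c0_onto c_v0 True show ?thesis by metis
    next
      case False
      have s_v: "s v \<in> incident_edges X v" using s[OF e(1)] .
      have "c (s v) v = g v" using c_inc[OF s_v] False unfolding L_def by simp
      moreover have "c a v \<noteq> g v" if "a \<in> incident_edges X v" "a \<noteq> s v" for a
        using c_inc[OF that(1)] that(2) False unfolding L_def by simp
      ultimately show ?thesis using e s_v by metis
    qed
    show "{..<k} \<subseteq> (\<lambda>e. c e v0) ` incident_edges X v0"
      using c0_onto c_v0 by (auto simp: image_iff)
  qed
qed

theorem theorem7p5:
  fixes X :: "('v, 'e) pre_multigraph" and d :: nat
  assumes "multigraph X" and "has_max_valency X d" and "d > 1"
  shows "(d = 2 \<longrightarrow>
            (\<forall>Y :: 'w pre_graph. cohesive_generalized_truncation X Y \<longrightarrow> chromatic_number Y = 2)) \<and>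
         (d > 2 \<longrightarrow>
            (\<forall>k::nat. 3 \<le> k \<and> k \<le> d \<longrightarrow>
               (\<exists>Y :: ('e \<times> 'v) pre_graph.
                  cohesive_generalized_truncation X Y \<and> chromatic_number Y = enat k)))"
  using assms chromatic_number_truncation_valency_2 truncation_with_chromatic_number
  \<comment> \<open>The type instance unfolds only the predicate for the given truncations of the
    case \<open>d = 2\<close>; the existential claim for \<open>d > 2\<close> keeps it
    folded.\<close>
  unfolding cohesive_generalized_truncation_def[of X "_ :: 'w pre_graph"] by blast

end
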